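(* Let $\mathcal{L}$ be a linear system of quadrics in $\mathbb{P}^3$ (over $\mathbb{C}$) of affine dimension $4$. If the Weddle locus $W(\mathcal{L})$ has fewer than $10$ singular points (e.g. if $W(\mathcal{L})$ is smooth), then the rank of $\mathcal{L}$ is at least $6$.
   Context: We work over $\mathbb{C}$, with homogeneous coordinates $[x_0:\dots:x_3]$ on $\mathbb{P}^3$. A linear system $\mathcal{L}$ of quadrics in $\mathbb{P}^3$ is (the projectivization of) a linear subspace of the space of quadratic forms in $x_0,\dots,x_3$; its (affine) dimension is the dimension of this vector subspace. If $\dim\mathcal{L}=4$ and $Q_0,\dots,Q_3$ generate $\mathcal{L}$, the Weddle matrix of $\mathcal{L}$ is the $4\times4$ matrix of linear forms $\mathbf{W}_{\mathcal{L}}=\big[\partial Q_k/\partial x_i\big]_{i,k=0,\dots,3}$, and the Weddle locus of $\mathcal{L}$ is $W(\mathcal{L})=\{P\in\mathbb{P}^3 : \det\mathbf{W}_{\mathcal{L}}|_P=0\}$. A singular point of $W(\mathcal{L})$ is a point of $\mathbb{P}^3$ at which all the partial derivatives of $\det\mathbf{W}_{\mathcal{L}}$ vanish (in particular, if $\det\mathbf{W}_{\mathcal{L}}$ is identically zero, every point is singular). The rank of $\mathcal{L}$ is the minimal $r$ such that there are linear forms $l_1,\dots,l_r$ in $x_0,\dots,x_3$ with $\mathcal{L}\subseteq\langle l_1^2,\dots,l_r^2\rangle$ (equivalently, the partially symmetric rank of the associated tensor). *)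

theory Defs
  imports "HOL-Analysis.Analysis" "HOL-Library.Function_Algebras"
begin

text \<open>
  Forms in the coordinates \<open>x\<^sub>0, \<dots>, x\<^sub>3\<close> are represented by the polynomial functions they define on
  \<open>\<complex>\<^sup>4\<close>; since the field is infinite, a polynomial is determined by its function. The coordinates
  are indexed by the type \<open>4\<close>, whose elements are \<open>0, 1, 2, 3\<close>.
\<close>

type_synonym form = "complex^4 \<Rightarrow> complex"

definition linear_form :: "form \<Rightarrow> bool" where
  "linear_form l \<longleftrightarrow> (\<exists>a :: 4 \<Rightarrow> complex. l = (\<lambda>x. \<Sum>i\<in>UNIV. a i * x $ i))"

definition quadratic_form :: "form \<Rightarrow> bool" where
  "quadratic_form q \<longleftrightarrow>
     (\<exists>a :: 4 \<Rightarrow> 4 \<Rightarrow> complex. q = (\<lambda>x. \<Sum>i\<in>UNIV. \<Sum>j\<in>UNIV. a i j * x $ i * x $ j))"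

definition form_scale :: "complex \<Rightarrow> form \<Rightarrow> form" where
  "form_scale c f = (\<lambda>x. c * f x)"

global_interpretation forms: vector_space form_scale
  by standard (auto simp: form_scale_def fun_eq_iff algebra_simps)

text \<open>A linear system is given by the vector subspace, not by its projectivization; its affine
  dimension is therefore \<open>forms.dim\<close>.\<close>

definition quadric_system :: "form set \<Rightarrow> bool" where
  "quadric_system L \<longleftrightarrow> forms.subspace L \<and> (\<forall>q\<in>L. quadratic_form q)"

definition partial :: "4 \<Rightarrow> form \<Rightarrow> form" where
  "partial i f = (\<lambda>x. deriv (\<lambda>t. f (x + t *s axis i 1)) 0)"

definition weddle_matrix :: "(4 \<Rightarrow> form) \<Rightarrow> complex^4 \<Rightarrow> complex^4^4" where
  "weddle_matrix Q x = (\<chi> i k. partial i (Q k) x)"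

definition weddle_det :: "(4 \<Rightarrow> form) \<Rightarrow> form" where
  "weddle_det Q = (\<lambda>x. det (weddle_matrix Q x))"

text \<open>A point of \<open>\<bbbP>\<^sup>3\<close> is the line \<open>vec.span {v}\<close> through the origin spanned by a nonzero vector
  \<open>v\<close> of homogeneous coordinates. Changing the generators \<open>Q\<close> of a system multiplies
  \<open>weddle_det Q\<close> by a nonzero constant, so the two sets below depend only on the system.\<close>

definition weddle_locus :: "(4 \<Rightarrow> form) \<Rightarrow> (complex^4) set set" where
  "weddle_locus Q = {vec.span {v} | v. v \<noteq> 0 \<and> weddle_det Q v = 0}"

text \<open>Membership in \<open>weddle_locus Q\<close> need not be required here: by Euler's formula it follows from
  the vanishing of the partial derivatives.\<close>

definition weddle_singular_points :: "(4 \<Rightarrow> form) \<Rightarrow> (complex^4) set set" where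
  "weddle_singular_points Q =
     {vec.span {v} | v. v \<noteq> 0 \<and> (\<forall>i. partial i (weddle_det Q) v = 0)}"

definition system_rank :: "form set \<Rightarrow> nat" where
  "system_rank L = (LEAST r. \<exists>l :: nat \<Rightarrow> form.
     (\<forall>i<r. linear_form (l i)) \<and> L \<subseteq> forms.span ((\<lambda>i x. (l i x)\<^sup>2) ` {..<r}))"

end

theory Submission
  imports Defs "HOL-Computational_Algebra.Fundamental_Theorem_Algebra"
begin

text \<open>
  If \<open>L\<close> lies in the span of five squares \<open>l\<^sub>0\<^sup>2, \<dots>, l\<^sub>4\<^sup>2\<close>, then expanding the Weddle determinant by
  multilinearity gives \<open>\<Sum>\<^sub>j d\<^sub>j \<Prod>\<^bsub>m \<noteq> j\<^esub> l\<^sub>m\<close>, where \<open>d\<^sub>j = 0\<close> as soon as the four forms other than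
  \<open>l\<^sub>j\<close> are linearly dependent. A point where three of the \<open>l\<^sub>m\<close> vanish is singular, because each
  product contains two of the three. If any four of the \<open>l\<^sub>m\<close> are independent, the ten triples give
  ten distinct points. Otherwise some \<open>d\<^sub>e\<close> vanishes, so \<open>l\<^sub>e\<close> divides the determinant; the
  complementary cubic meets the plane \<open>l\<^sub>e = 0\<close> in infinitely many points, all of them singular.
\<close>

section \<open>Linear forms as coefficient vectors, and their common zeros\<close>

text \<open>Bilinear, without conjugation: \<open>cdot a\<close> is the linear form with coefficient
  vector \<open>a\<close>, not a Hermitian product.\<close>

definition cdot :: "complex^'n \<Rightarrow> complex^'n \<Rightarrow> complex" where
  "cdot a x = (\<Sum>i\<in>UNIV. a $ i * x $ i)"

lemma cdot_add: "cdot a (x + y) = cdot a x + cdot a y"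
  by (simp add: cdot_def algebra_simps sum.distrib)

lemma cdot_smult: "cdot a (t *s x) = t * cdot a x"
  by (simp add: cdot_def algebra_simps sum_distrib_left)

lemma cdot_axis: "cdot a (axis i 1) = a $ i"
  by (simp add: cdot_def axis_def if_distrib cong: if_cong)

lemma cdot_axis_left: "cdot (axis i 1) x = x $ i"
  by (simp add: cdot_def axis_def if_distrib[of "\<lambda>z. z * _"] cong: if_cong)

lemma cdot_zero_right: "cdot a 0 = 0"
  by (simp add: cdot_def)

lemma linear_form_iff_cdot: "linear_form l \<longleftrightarrow> (\<exists>a. l = cdot a)"
proof
  assume "linear_form l"
  then obtain a where "l = (\<lambda>x. \<Sum>i\<in>UNIV. a i * x $ i)"
    by (auto simp: linear_form_def)
  then have "l = cdot (vec_lambda a)"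
    by (simp add: cdot_def fun_eq_iff)
  then show "\<exists>a. l = cdot a" ..
next
  assume "\<exists>a. l = cdot a"
  then show "linear_form l"
    unfolding linear_form_def cdot_def by (metis (no_types))
qed

lemma det_zero_iff_kernel:
  fixes M :: "'a::field^'n^'n"
  shows "det M = 0 \<longleftrightarrow> (\<exists>x. x \<noteq> 0 \<and> M *v x = 0)"
  using invertible_det_nz[of M] invertible_left_inverse[of M] matrix_left_invertible_ker[of M]
  by auto

text \<open>Translates linear dependence of forms into a common nontrivial zero, the shape in which
  dependence is used below.\<close>

lemma det_rows_zero_iff:
  fixes r :: "'n \<Rightarrow> complex^'n"
  shows "det (\<chi> i. r i) = 0 \<longleftrightarrow> (\<exists>x. x \<noteq> 0 \<and> (\<forall>i. cdot (r i) x = 0))"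
  by (simp add: det_zero_iff_kernel matrix_vector_mult_def cdot_def vec_eq_iff[of "vec_lambda _"])

text \<open>Three equations in four unknowns. The forms may repeat, so this also serves for one or
  two equations.\<close>

lemma three_forms_common_zero:
  fixes a b c :: "complex^4"
  obtains x where "x \<noteq> 0" "cdot a x = 0" "cdot b x = 0" "cdot c x = 0"
proof -
  \<comment> \<open>Index \<open>3\<close> also falls into the last branch, so rows \<open>2\<close>
    and \<open>3\<close> coincide and the determinant vanishes.\<close>
  define r :: "4 \<Rightarrow> complex^4" where "r = (\<lambda>i. if i = 0 then a else if i = 1 then b else c)"
  have "(2::4) \<noteq> 3" and nz: "(1::4) \<noteq> 0" "(2::4) \<noteq> 0" "(2::4) \<noteq> 1"
    by simp_all
  moreover have "r 2 = r 3"
    by (simp add: r_def)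
  ultimately have "det (\<chi> i. r i) = 0"
    by (intro det_identical_rows[of 2 3]) (auto simp: row_def)
  then obtain x where "x \<noteq> 0" and x: "\<And>i. cdot (r i) x = 0"
    by (auto simp: det_rows_zero_iff)
  with x[of 0] x[of 1] x[of 2] nz that show thesis
    by (simp add: r_def)
qed

section \<open>Expansion of the Weddle determinant\<close>

text \<open>Multilinearity in the rows: \<open>f\<close> chooses one summand from each row. The
  Leibniz formula reduces this to distributing a product over sums.\<close>

lemma det_sum_rows:
  fixes r :: "'n::finite \<Rightarrow> 'b \<Rightarrow> 'a::comm_ring_1^'n"
  assumes "finite J"
  shows "det (\<chi> i. \<Sum>j\<in>J. r i j) = (\<Sum>f\<in>{f. range f \<subseteq> J}. det (\<chi> i. r i (f i)))"
proof -
  have PiE: "{f. range f \<subseteq> J} = (UNIV \<rightarrow>\<^sub>E J)"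
    by auto
  have "det (\<chi> i. \<Sum>j\<in>J. r i j) =
      (\<Sum>p | p permutes UNIV. of_int (sign p) * (\<Prod>i\<in>UNIV. \<Sum>j\<in>J. r i j $ p i))"
    by (simp add: det_def)
  also have "\<dots> = (\<Sum>p | p permutes (UNIV::'n set). \<Sum>f\<in>{f. range f \<subseteq> J}.
      of_int (sign p) * (\<Prod>i\<in>UNIV. r i (f i) $ p i))"
    using assms by (simp add: PiE prod_sum_PiE sum_distrib_left)
  also have "\<dots> = (\<Sum>f\<in>{f. range f \<subseteq> J}. det (\<chi> i. r i (f i)))"
    by (subst sum.swap) (simp add: det_def)
  finally show ?thesis .
qed

lemma has_field_derivative_cdot:
  "((\<lambda>t. cdot a (x + t *s v)) has_field_derivative cdot a v) (at t)"
  unfolding cdot_add cdot_smult by (auto intro!: derivative_eq_intros)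

lemma partial_sum_squares:
  "partial i (\<lambda>x. \<Sum>j\<in>J. c j * (cdot (a j) x)\<^sup>2) x = (\<Sum>j\<in>J. 2 * c j * cdot (a j) x * a j $ i)"
proof -
  have "((\<lambda>t. \<Sum>j\<in>J. c j * (cdot (a j) (x + t *s axis i 1))\<^sup>2) has_field_derivative
      (\<Sum>j\<in>J. 2 * c j * cdot (a j) x * a j $ i)) (at 0)"
    by (auto intro!: derivative_eq_intros has_field_derivative_cdot sum.cong simp: cdot_axis)
  then show ?thesis
    unfolding partial_def by (rule DERIV_imp_deriv)
qed

text \<open>Row \<open>k\<close> of the transposed Weddle matrix is the gradient of
  \<open>Q k\<close>, a combination of the vectors \<open>a j\<close>. Expanding by rows, a choice
  that takes the same \<open>j\<close> twice produces two equal rows, so only injective choices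
  survive.\<close>

lemma weddle_det_sum_squares:
  fixes a :: "'b \<Rightarrow> complex^4"
  assumes "finite J" and Q: "\<And>k. Q k = (\<lambda>x. \<Sum>j\<in>J. c k j * (cdot (a j) x)\<^sup>2)"
  shows "weddle_det Q x =
    (\<Sum>f | inj f \<and> range f \<subseteq> J.
       (\<Prod>k\<in>UNIV. 2 * c k (f k)) * det (\<chi> k. a (f k)) * (\<Prod>k\<in>UNIV. cdot (a (f k)) x))"
proof -
  have "weddle_det Q x = det (transpose (weddle_matrix Q x))"
    by (simp add: weddle_det_def)
  also have "transpose (weddle_matrix Q x) = (\<chi> k. \<Sum>j\<in>J. (2 * c k j * cdot (a j) x) *s a j)"
    by (simp add: transpose_def weddle_matrix_def Q partial_sum_squares vec_eq_iff)
  also have "det \<dots> = (\<Sum>f | range f \<subseteq> J.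
       (\<Prod>k\<in>UNIV. 2 * c k (f k) * cdot (a (f k)) x) * det (\<chi> k. a (f k)))"
    by (simp only: det_sum_rows[OF \<open>finite J\<close>] det_rows_mul)
  also have "\<dots> = (\<Sum>f | inj f \<and> range f \<subseteq> J.
       (\<Prod>k\<in>UNIV. 2 * c k (f k) * cdot (a (f k)) x) * det (\<chi> k. a (f k)))"
  proof (rule sum.mono_neutral_right)
    have "{f :: 4 \<Rightarrow> 'b. range f \<subseteq> J} = (UNIV \<rightarrow>\<^sub>E J)"
      by auto
    then show "finite {f :: 4 \<Rightarrow> 'b. range f \<subseteq> J}"
      using \<open>finite J\<close> by (simp add: finite_PiE)
    have "det (\<chi> k. a (f k)) = 0" if "\<not> inj f" for f :: "4 \<Rightarrow> 'b"
    proof -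
      from that obtain k k' where "k \<noteq> k'" "f k = f k'"
        by (auto simp: inj_def)
      then show ?thesis
        by (intro det_identical_rows[of k k']) (auto simp: row_def)
    qed
    then show "\<forall>f\<in>{f. range f \<subseteq> J} - {f. inj f \<and> range f \<subseteq> J}.
        (\<Prod>k\<in>UNIV. 2 * c k (f k) * cdot (a (f k)) x) * det (\<chi> k. a (f k)) = 0"
      by auto
  qed auto
  finally show ?thesis
    by (simp add: prod.distrib mult_ac)
qed

section \<open>Zeros of a form on a line\<close>

text \<open>The top coefficient may vanish, so only a degree bound holds. The induction carries the
  bound along because it kills the coefficient just above the top one.\<close>

lemma prod_linear_coeff:
  fixes \<alpha> \<beta> :: "'b \<Rightarrow> 'a::comm_ring_1"
  assumes "finite S"
  shows "degree (\<Prod>k\<in>S. [:\<alpha> k, \<beta> k:]) \<le> card S \<and>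
    coeff (\<Prod>k\<in>S. [:\<alpha> k, \<beta> k:]) (card S) = (\<Prod>k\<in>S. \<beta> k)"
  using assms
proof induction
  case (insert s S)
  let ?P = "\<Prod>k\<in>S. [:\<alpha> k, \<beta> k:]"
  have "degree ([:\<alpha> s, \<beta> s:] * ?P) \<le> Suc (card S)"
    by (rule order.trans[OF degree_mult_le]) (use insert.IH in auto)
  moreover have "coeff ?P (Suc (card S)) = 0"
    using insert.IH by (intro coeff_eq_0) auto
  ultimately show ?case
    using insert by simp
qed auto

text \<open>Restricted to the line \<open>t *s p + q\<close>, the form becomes a polynomial in
  \<open>t\<close> whose coefficient at degree \<open>Suc n\<close> is the value of the form at
  \<open>p\<close>. This is nonzero, so the polynomial is nonconstant and has a complex
  root.\<close>

lemma sum_prod_cdot_root: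
  fixes a :: "'b \<Rightarrow> 'c \<Rightarrow> complex^'n"
  assumes "\<And>f. f \<in> F \<Longrightarrow> finite (S f) \<and> card (S f) = Suc n"
    and "(\<Sum>f\<in>F. e f * (\<Prod>k\<in>S f. cdot (a f k) p)) \<noteq> 0"
  shows "\<exists>t. (\<Sum>f\<in>F. e f * (\<Prod>k\<in>S f. cdot (a f k) (t *s p + q))) = 0"
proof -
  define P where "P = (\<Sum>f\<in>F. smult (e f) (\<Prod>k\<in>S f. [:cdot (a f k) q, cdot (a f k) p:]))"
  have "coeff P (Suc n) = (\<Sum>f\<in>F. e f * (\<Prod>k\<in>S f. cdot (a f k) p))"
    unfolding P_def coeff_sum coeff_smult
  proof (rule sum.cong)
    fix f assume "f \<in> F"
    then have "finite (S f)" "card (S f) = Suc n"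
      using assms(1) by auto
    with prod_linear_coeff[of "S f" "\<lambda>k. cdot (a f k) q" "\<lambda>k. cdot (a f k) p"]
    show "e f * coeff (\<Prod>k\<in>S f. [:cdot (a f k) q, cdot (a f k) p:]) (Suc n) =
        e f * (\<Prod>k\<in>S f. cdot (a f k) p)"
      by simp
  qed simp
  then have "coeff P (Suc n) \<noteq> 0"
    using assms(2) by simp
  then have "degree P > 0"
    using le_degree[of P "Suc n"] by simp
  then have "\<not> constant (poly P)"
    by (simp add: constant_degree)
  then obtain t where "poly P t = 0"
    using fundamental_theorem_of_algebra by blast
  then have "(\<Sum>f\<in>F. e f * (\<Prod>k\<in>S f. cdot (a f k) (t *s p + q))) = 0"
    by (simp add: P_def poly_sum poly_prod cdot_add cdot_smult add.commute)
  then show ?thesis ..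
qed

section \<open>Spans of squares and existence of a finite rank\<close>

text \<open>The sums on the right form a subspace containing the generators. Coefficients are
  attached to indices rather than to squares, so coinciding squares cause no trouble.\<close>

lemma span_image_squares:
  assumes "q \<in> forms.span ((\<lambda>j x. (l j x)\<^sup>2) ` J)" "finite J"
  shows "\<exists>c. q = (\<lambda>x. \<Sum>j\<in>J. c j * (l j x)\<^sup>2)"
proof -
  let ?V = "{q. \<exists>c. q = (\<lambda>x. \<Sum>j\<in>J. c j * (l j x)\<^sup>2)}"
  have "forms.subspace ?V"
  proof (rule forms.subspaceI)
    show "0 \<in> ?V"
      by (auto simp: fun_eq_iff intro!: exI[of _ "\<lambda>_. 0"])
  next
    fix x y assume "x \<in> ?V" "y \<in> ?V"
    then obtain c d where "x = (\<lambda>x. \<Sum>j\<in>J. c j * (l j x)\<^sup>2)" "y = (\<lambda>x. \<Sum>j\<in>J. d j * (l j x)\<^sup>2)"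
      by auto
    then have "x + y = (\<lambda>x. \<Sum>j\<in>J. (c j + d j) * (l j x)\<^sup>2)"
      by (simp add: fun_eq_iff algebra_simps sum.distrib)
    then show "x + y \<in> ?V"
      unfolding mem_Collect_eq by (rule exI[of _ "\<lambda>j. c j + d j"])
  next
    fix s x assume "x \<in> ?V"
    then obtain c where "x = (\<lambda>x. \<Sum>j\<in>J. c j * (l j x)\<^sup>2)"
      by auto
    then have "form_scale s x = (\<lambda>x. \<Sum>j\<in>J. (s * c j) * (l j x)\<^sup>2)"
      by (simp add: fun_eq_iff form_scale_def algebra_simps sum_distrib_left)
    then show "form_scale s x \<in> ?V"
      unfolding mem_Collect_eq by (rule exI[of _ "\<lambda>j. s * c j"])
  qed
  moreover have "(\<lambda>x. (l j x)\<^sup>2) \<in> ?V" if "j \<in> J" for j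
  proof -
    have "(\<lambda>x. (l j x)\<^sup>2) = (\<lambda>x. \<Sum>i\<in>J. (if i = j then 1 else 0) * (l i x)\<^sup>2)"
      using that assms(2) by (simp add: if_distrib[of "\<lambda>z. z * _"] fun_eq_iff cong: if_cong)
    then show ?thesis
      unfolding mem_Collect_eq by (rule exI[of _ "\<lambda>i. if i = j then 1 else 0"])
  qed
  ultimately have "forms.span ((\<lambda>j x. (l j x)\<^sup>2) ` J) \<subseteq> ?V"
    by (intro forms.span_minimal) auto
  with assms(1) show ?thesis
    by auto
qed

lemma sum_fun_apply: "(\<Sum>u\<in>A. f u) x = (\<Sum>u\<in>A. f u x)"
  by (induction A rule: infinite_finite_induct) auto

text \<open>Polarization: \<open>x\<^sub>i x\<^sub>j = ((x\<^sub>i + x\<^sub>j)\<^sup>2 - (x\<^sub>i - x\<^sub>j)\<^sup>2) / 4\<close>.\<close>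

lemma system_rank_witness:
  assumes "quadric_system L"
  shows "\<exists>r (l :: nat \<Rightarrow> form). (\<forall>i<r. linear_form (l i)) \<and>
    L \<subseteq> forms.span ((\<lambda>i x. (l i x)\<^sup>2) ` {..<r})"
proof -
  define m :: "4 \<times> 4 \<times> bool \<Rightarrow> form" where
    "m = (\<lambda>(i, j, b). cdot (axis i 1 + (if b then 1 else - 1) *s axis j 1))"
  have cdot_left: "cdot (axis i 1 + s *s axis j 1) x = x $ i + s * x $ j" for i j s and x :: "complex^4"
  proof -
    have "cdot (axis i 1 + s *s axis j 1) x = cdot x (axis i 1 + s *s axis j 1)"
      by (simp add: cdot_def mult.commute)
    then show ?thesis
      by (simp add: cdot_add cdot_smult cdot_axis)
  qed
  \<comment> \<open>The rank is defined through forms numbered by naturals below \<open>r\<close>,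
    hence this enumeration of the finite index type.\<close>
  obtain h :: "nat \<Rightarrow> 4 \<times> 4 \<times> bool" where "bij_betw h {0..<card (UNIV :: (4 \<times> 4 \<times> bool) set)} UNIV"
    using ex_bij_betw_nat_finite[of "UNIV :: (4 \<times> 4 \<times> bool) set"] finite by blast
  then obtain r where h: "h ` {..<r} = UNIV"
    by (metis atLeast0LessThan bij_betw_imp_surj_on)
  let ?S = "range (\<lambda>k x. (m k x)\<^sup>2)"
  have S: "(\<lambda>i x. (m (h i) x)\<^sup>2) ` {..<r} = ?S"
    unfolding h[symmetric] image_image ..
  have "q \<in> forms.span ?S" if "q \<in> L" for q
  proof -
    from that assms obtain A where A: "q = (\<lambda>x. \<Sum>i\<in>UNIV. \<Sum>j\<in>UNIV. A i j * x $ i * x $ j)"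
      unfolding quadric_system_def quadratic_form_def by blast
    have "q = (\<Sum>i\<in>UNIV. \<Sum>j\<in>UNIV. form_scale (A i j / 4)
        ((\<lambda>x. (m (i, j, True) x)\<^sup>2) - (\<lambda>x. (m (i, j, False) x)\<^sup>2)))"
    proof
      fix x
      have "A i j * x $ i * x $ j = A i j / 4 * ((m (i, j, True) x)\<^sup>2 - (m (i, j, False) x)\<^sup>2)" for i j
        unfolding m_def prod.case cdot_left by (simp add: power2_eq_square algebra_simps)
      then show "q x = (\<Sum>i\<in>UNIV. \<Sum>j\<in>UNIV. form_scale (A i j / 4)
          ((\<lambda>x. (m (i, j, True) x)\<^sup>2) - (\<lambda>x. (m (i, j, False) x)\<^sup>2))) x"
        by (simp only: A sum_fun_apply form_scale_def minus_apply)
    qed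
    also have "\<dots> \<in> forms.span ?S"
      by (intro forms.span_sum forms.span_scale forms.span_diff forms.span_base rangeI)
    finally show ?thesis .
  qed
  then have "L \<subseteq> forms.span ((\<lambda>i x. (m (h i) x)\<^sup>2) ` {..<r})"
    unfolding S by blast
  moreover have "linear_form (m (h i))" for i
    unfolding linear_form_iff_cdot m_def by (auto split: prod.split)
  ultimately show ?thesis
    by (intro exI[of _ r] exI[of _ "\<lambda>i. m (h i)"]) blast
qed

section \<open>Projective points and vanishing partial derivatives\<close>

lemma span_singleton_eqE:
  assumes "vec.span {v} = vec.span {w :: 'a::field^'n}"
  obtains k where "v = k *s w"
proof -
  have "v \<in> vec.span {w}"
    unfolding assms[symmetric] by (simp add: vec.span_base)
  with that show thesis
    by (auto simp: vec.span_singleton)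
qed

text \<open>By the product rule, each term of the derivative drops only one factor, so at least one
  of the two vanishing factors remains.\<close>

lemma partial_sum_prod_cdot_eq_0:
  fixes a :: "'b \<Rightarrow> complex^4" and f :: "'c \<Rightarrow> 'd::finite \<Rightarrow> 'b"
  assumes "\<And>u. u \<in> F \<Longrightarrow> \<exists>k k'. k \<noteq> k' \<and> cdot (a (f u k)) x = 0 \<and> cdot (a (f u k')) x = 0"
  shows "partial i (\<lambda>x. \<Sum>u\<in>F. e u * (\<Prod>k\<in>UNIV. cdot (a (f u k)) x)) x = 0"
proof -
  have "((\<lambda>t. \<Prod>k\<in>UNIV. cdot (a (f u k)) (x + t *s axis i 1)) has_field_derivative 0) (at 0)"
    if u: "u \<in> F" for u
  proof -
    from assms[OF u] obtain k k' where k: "k \<noteq> k'" "cdot (a (f u k)) x = 0" "cdot (a (f u k')) x = 0"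
      by blast
    have "(\<Prod>j\<in>UNIV - {m}. cdot (a (f u j)) (x + 0 *s axis i 1)) = 0" for m
      using k by (intro prod_zero) (auto intro: bexI[of _ "if m = k then k' else k"])
    moreover have "((\<lambda>t. \<Prod>k\<in>UNIV. cdot (a (f u k)) (x + t *s axis i 1)) has_field_derivative
        (\<Sum>m\<in>UNIV. cdot (a (f u m)) (axis i 1) *
          (\<Prod>j\<in>UNIV - {m}. cdot (a (f u j)) (x + 0 *s axis i 1)))) (at 0)"
      by (rule has_field_derivative_prod) (rule has_field_derivative_cdot)
    ultimately show ?thesis
      by (simp only: mult_zero_right sum.neutral_const)
  qed
  then have "((\<lambda>t. \<Sum>u\<in>F. e u * (\<Prod>k\<in>UNIV. cdot (a (f u k)) (x + t *s axis i 1)))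
      has_field_derivative (\<Sum>u\<in>F. e u * 0)) (at 0)"
    by (intro DERIV_sum DERIV_cmult)
  then show ?thesis
    unfolding partial_def by (intro DERIV_imp_deriv) simp
qed

text \<open>Both terms of the product rule contain a vanishing factor. This makes the points common
  to a plane component and the residual surface singular.\<close>

lemma partial_cdot_mult_eq_0:
  assumes "cdot b x = 0" "G x = 0"
    and "((\<lambda>t. G (x + t *s axis i 1)) has_field_derivative d) (at 0)"
  shows "partial i (\<lambda>x. cdot b x * G x) x = 0"
proof -
  have "((\<lambda>t. cdot b (x + t *s axis i 1) * G (x + t *s axis i 1)) has_field_derivative 0) (at 0)"
    using assms by (auto intro!: derivative_eq_intros has_field_derivative_cdot)
  then show ?thesis
    unfolding partial_def by (rule DERIV_imp_deriv)
qed

text \<open>Inside the plane, the lines joining \<open>p\<close> to the points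
  \<open>q + s *s r\<close> each contain a zero of \<open>G\<close>, found by the root lemma if
  \<open>G p\<close> is nonzero. Independence of \<open>p\<close>, \<open>q\<close>,
  \<open>r\<close> makes these zeros distinct for distinct \<open>s\<close>.\<close>

lemma infinite_zeros_on_plane:
  fixes a :: "'b \<Rightarrow> 'c \<Rightarrow> complex^4"
  assumes G_def: "\<And>x. G x = (\<Sum>f\<in>F. e f * (\<Prod>k\<in>S f. cdot (a f k) x))"
    and S: "\<And>f. f \<in> F \<Longrightarrow> finite (S f) \<and> card (S f) = Suc n"
  shows "infinite {vec.span {v} | v. v \<noteq> 0 \<and> cdot b v = 0 \<and> G v = 0}"
proof -
  have "G 0 = 0"
    unfolding G_def
  proof (rule sum.neutral, rule ballI)
    fix f assume "f \<in> F"
    then have "card (S f) = Suc n"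
      using S by blast
    then show "e f * (\<Prod>k\<in>S f. cdot (a f k) 0) = 0"
      by (simp add: cdot_zero_right)
  qed
  \<comment> \<open>If \<open>G\<close> vanishes on the whole plane, any nonzero point of it serves,
    and \<open>t = 0\<close> will be a root for every \<open>s\<close>.\<close>
  obtain p where p: "p \<noteq> 0" "cdot b p = 0" "G p \<noteq> 0 \<or> (\<forall>x. cdot b x = 0 \<longrightarrow> G x = 0)"
  proof (cases "\<exists>x. cdot b x = 0 \<and> G x \<noteq> 0")
    case True
    then show ?thesis
      using \<open>G 0 = 0\<close> that by metis
  next
    case False
    then show ?thesis
      using three_forms_common_zero[of b b b] that by metis
  qed
  \<comment> \<open>The vectors are chosen in triangular position: \<open>q\<close> vanishes in
    coordinate \<open>i\<close>, and \<open>r\<close> in coordinates \<open>i\<close> and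
    \<open>j\<close>.\<close>
  obtain i where i: "p $ i \<noteq> 0"
    using \<open>p \<noteq> 0\<close> by (auto simp: vec_eq_iff)
  obtain q where q: "q \<noteq> 0" "cdot b q = 0" "q $ i = 0"
    using three_forms_common_zero[of b "axis i 1" "axis i 1"] by (auto simp: cdot_axis_left)
  obtain j where j: "q $ j \<noteq> 0"
    using \<open>q \<noteq> 0\<close> by (auto simp: vec_eq_iff)
  obtain r where r: "r \<noteq> 0" "cdot b r = 0" "r $ i = 0" "r $ j = 0"
    using three_forms_common_zero[of b "axis i 1" "axis j 1"] by (auto simp: cdot_axis_left)
  have "\<exists>t. G (t *s p + (q + s *s r)) = 0" for s
  proof (cases "G p = 0")
    case True
    then have "G (0 *s p + (q + s *s r)) = 0"
      using p(2,3) q(2) r(2) by (simp add: cdot_add cdot_smult)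
    then show ?thesis ..
  next
    case False
    then show ?thesis
      unfolding G_def by (intro sum_prod_cdot_root[OF S]) auto
  qed
  then obtain t where t: "\<And>s. G (t s *s p + (q + s *s r)) = 0"
    by metis
  define z where "z s = t s *s p + (q + s *s r)" for s
  have "z s \<noteq> 0" for s
  proof
    assume "z s = 0"
    then have z: "t s * p $ m + (q $ m + s * r $ m) = 0" for m
      by (simp add: z_def vec_eq_iff)
    from z[of i] z[of j] i j q r show False
      by simp
  qed
  then have "range (\<lambda>s. vec.span {z s}) \<subseteq> {vec.span {v} | v. v \<noteq> 0 \<and> cdot b v = 0 \<and> G v = 0}"
    using p q r t by (fastforce simp: z_def cdot_add cdot_smult)
  moreover have "inj (\<lambda>s. vec.span {z s})"
  proof (rule injI)
    fix s s' assume "vec.span {z s} = vec.span {z s'}"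
    then obtain k where "z s = k *s z s'"
      by (rule span_singleton_eqE)
    then have z: "t s * p $ m + (q $ m + s * r $ m) = k * (t s' * p $ m + (q $ m + s' * r $ m))" for m
      by (metis z_def vector_add_component vector_smult_component)
    \<comment> \<open>Coordinate \<open>i\<close> compares the multiples of \<open>p\<close>,
      coordinate \<open>j\<close> then forces the scalar to be \<open>1\<close>, and a nonzero
      coordinate of \<open>r\<close> finally gives \<open>s = s'\<close>.\<close>
    have tk: "t s = k * t s'"
      using z[of i] i q r by simp
    with z[of j] j r have "k = 1"
      by (simp add: algebra_simps)
    obtain m where "r $ m \<noteq> 0"
      using \<open>r \<noteq> 0\<close> by (auto simp: vec_eq_iff)
    with z[of m] tk \<open>k = 1\<close> show "s = s'"
      by simp
  qed
  then have "infinite (range (\<lambda>s. vec.span {z s}))"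
    using finite_imageD infinite_UNIV_char_0 by blast
  ultimately show ?thesis
    using finite_subset by blast
qed

section \<open>Five squares in general and in special position\<close>

text \<open>Each triple \<open>T\<close> yields a singular point \<open>p T\<close>. The forms
  vanishing there are exactly those of \<open>T\<close>, so the triple is recovered from the point,
  and there are \<open>5 choose 3\<close> triples.\<close>

lemma card_weddle_singular_points_general:
  fixes a :: "'b \<Rightarrow> complex^4"
  assumes J: "finite J" "card J = 5"
    and Q: "\<And>k. Q k = (\<lambda>x. \<Sum>j\<in>J. c k j * (cdot (a j) x)\<^sup>2)"
    and general: "\<And>e x. e \<in> J \<Longrightarrow> (\<And>j. j \<in> J - {e} \<Longrightarrow> cdot (a j) x = 0) \<Longrightarrow> x = 0"
    and fin: "finite (weddle_singular_points Q)"
  shows "10 \<le> card (weddle_singular_points Q)"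
proof -
  let ?\<T> = "{T. T \<subseteq> J \<and> card T = 3}"
  have "\<exists>x. x \<noteq> 0 \<and> (\<forall>j\<in>T. cdot (a j) x = 0)" if "T \<in> ?\<T>" for T
  proof -
    from that obtain t u v where "T = {t, u, v}"
      by (auto simp: card_3_iff)
    then show ?thesis
      using three_forms_common_zero[of "a t" "a u" "a v"] by auto
  qed
  then obtain p where "\<forall>T\<in>?\<T>. p T \<noteq> 0 \<and> (\<forall>j\<in>T. cdot (a j) (p T) = 0)"
    using bchoice[of ?\<T> "\<lambda>T x. x \<noteq> 0 \<and> (\<forall>j\<in>T. cdot (a j) x = 0)"] by blast
  then have p0: "\<And>T. T \<in> ?\<T> \<Longrightarrow> p T \<noteq> 0"
    and p: "\<And>T j. T \<in> ?\<T> \<Longrightarrow> j \<in> T \<Longrightarrow> cdot (a j) (p T) = 0"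
    by blast+
  \<comment> \<open>A fourth form vanishing at \<open>p T\<close> would leave only one index
    \<open>e\<close>, and \<open>general\<close> would force \<open>p T = 0\<close>.\<close>
  have zeros: "j \<in> T" if T: "T \<in> ?\<T>" and j: "j \<in> J" "cdot (a j) (p T) = 0" for T j
  proof (rule ccontr)
    assume "j \<notin> T"
    have "finite T"
      using T J finite_subset by blast
    then have "card (J - insert j T) = 1"
      using T J j \<open>j \<notin> T\<close> by (subst card_Diff_subset) auto
    then obtain e where e: "J - insert j T = {e}"
      using card_1_singletonE by blast
    have "p T = 0"
    proof (rule general)
      show "e \<in> J"
        using e by auto
    next
      fix i assume "i \<in> J - {e}"
      then have "i \<in> insert j T"
        using e by auto
      then show "cdot (a i) (p T) = 0"
        using p[OF T] j by auto
    qed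
    with p0[OF T] show False
      by simp
  qed
  have "partial i (weddle_det Q) (p T) = 0" if T: "T \<in> ?\<T>" for i T
    unfolding weddle_det_sum_squares[OF J(1) Q, abs_def]
  proof (rule partial_sum_prod_cdot_eq_0)
    fix f :: "4 \<Rightarrow> 'b" assume "f \<in> {f. inj f \<and> range f \<subseteq> J}"
    then have f: "inj f" "range f \<subseteq> J"
      by auto
    have "finite T"
      using T J finite_subset by blast
    \<comment> \<open>Pigeonhole: four indices and three indices among five share at least two, so
      two factors of every product vanish at \<open>p T\<close>.\<close>
    then have "card (range f) + card T = card (range f \<union> T) + card (range f \<inter> T)"
      by (intro card_Un_Int) auto
    moreover have "card (range f) = 4"
      using f by (simp add: card_image)
    moreover have "card (range f \<union> T) \<le> 5"
      using card_mono[of J "range f \<union> T"] f T J by auto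
    ultimately have "\<not> card (range f \<inter> T) \<le> Suc 0"
      using T by auto
    then obtain k k' where "f k \<noteq> f k'" "f k \<in> T" "f k' \<in> T"
      using \<open>finite T\<close> by (subst (asm) card_le_Suc0_iff_eq) auto
    then show "\<exists>k k'. k \<noteq> k' \<and> cdot (a (f k)) (p T) = 0 \<and> cdot (a (f k')) (p T) = 0"
      using p[OF T] by metis
  qed
  then have sub: "(\<lambda>T. vec.span {p T}) ` ?\<T> \<subseteq> weddle_singular_points Q"
    using p0 unfolding weddle_singular_points_def by blast
  have subset: "T \<subseteq> T'" if "T \<in> ?\<T>" "T' \<in> ?\<T>" "vec.span {p T} = vec.span {p T'}" for T T'
  proof
    fix j assume "j \<in> T"
    from that(3)[symmetric] obtain k where "p T' = k *s p T"
      by (rule span_singleton_eqE)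
    with p[OF that(1) \<open>j \<in> T\<close>] have "cdot (a j) (p T') = 0"
      by (simp add: cdot_smult)
    with zeros that \<open>j \<in> T\<close> show "j \<in> T'"
      by blast
  qed
  have "inj_on (\<lambda>T. vec.span {p T}) ?\<T>"
  proof (rule inj_onI)
    fix T T' assume "T \<in> ?\<T>" "T' \<in> ?\<T>" "vec.span {p T} = vec.span {p T'}"
    then show "T = T'"
      using subset[of T T'] subset[of T' T] by simp
  qed
  moreover have "card ?\<T> = 5 choose 3"
    using n_subsets[OF J(1), of 3] J(2) by simp
  moreover have "5 choose 3 = (10 :: nat)"
    by (simp add: eval_nat_numeral)
  ultimately show ?thesis
    using card_mono[OF fin sub] by (simp add: card_image)
qed

text \<open>The common zero \<open>y\<close> kills the determinant of every choice avoiding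
  \<open>e\<close>, so each surviving term contains the factor \<open>cdot (a e)\<close>, and
  \<open>G\<close> is the residual cubic.\<close>

lemma infinite_weddle_singular_points_special:
  fixes a :: "'b \<Rightarrow> complex^4"
  assumes J: "finite J"
    and Q: "\<And>k. Q k = (\<lambda>x. \<Sum>j\<in>J. c k j * (cdot (a j) x)\<^sup>2)"
    and y: "y \<noteq> 0" "\<And>j. j \<in> J - {e} \<Longrightarrow> cdot (a j) y = 0"
  shows "infinite (weddle_singular_points Q)"
proof -
  define d where "d f = (\<Prod>k\<in>UNIV. 2 * c k (f k)) * det (\<chi> k. a (f k))" for f
  define F where "F = {f :: 4 \<Rightarrow> 'b. inj f \<and> range f \<subseteq> J \<and> e \<in> range f}"
  \<comment> \<open>The positions left after removing the one taken by \<open>e\<close>; for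
    \<open>f\<close> in \<open>F\<close>, injectivity makes them exactly three.\<close>
  define S where "S f = {k :: 4. f k \<noteq> e}" for f
  define G where "G x = (\<Sum>f\<in>F. d f * (\<Prod>k\<in>S f. cdot (a (f k)) x))" for x
  have S: "\<exists>m. f m = e \<and> S f = UNIV - {m}" if "f \<in> F" for f
    using that by (auto simp: F_def S_def inj_def)
  have "weddle_det Q x = cdot (a e) x * G x" for x
  proof -
    have "weddle_det Q x = (\<Sum>f | inj f \<and> range f \<subseteq> J. d f * (\<Prod>k\<in>UNIV. cdot (a (f k)) x))"
      by (simp add: weddle_det_sum_squares[OF J Q] d_def)
    also have "\<dots> = (\<Sum>f\<in>F. d f * (\<Prod>k\<in>UNIV. cdot (a (f k)) x))"
    proof (rule sum.mono_neutral_right)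
      have "{f :: 4 \<Rightarrow> 'b. inj f \<and> range f \<subseteq> J} \<subseteq> (UNIV \<rightarrow>\<^sub>E J)"
        by auto
      then show "finite {f :: 4 \<Rightarrow> 'b. inj f \<and> range f \<subseteq> J}"
        by (rule finite_subset) (simp add: J finite_PiE)
      show "F \<subseteq> {f. inj f \<and> range f \<subseteq> J}"
        by (auto simp: F_def)
      have "d f = 0" if "range f \<subseteq> J" "e \<notin> range f" for f
      proof -
        have "cdot (a (f k)) y = 0" for k
          using that by (intro y(2)) auto
        with y(1) show ?thesis
          by (auto simp: d_def det_rows_zero_iff)
      qed
      then show "\<forall>f\<in>{f. inj f \<and> range f \<subseteq> J} - F. d f * (\<Prod>k\<in>UNIV. cdot (a (f k)) x) = 0"
        by (auto simp: F_def)
    qed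
    also have "\<dots> = (\<Sum>f\<in>F. cdot (a e) x * (d f * (\<Prod>k\<in>S f. cdot (a (f k)) x)))"
    proof (rule sum.cong)
      fix f assume "f \<in> F"
      with S obtain m where m: "f m = e" "S f = UNIV - {m}"
        by blast
      have "(\<Prod>k\<in>UNIV. cdot (a (f k)) x) = cdot (a (f m)) x * (\<Prod>k\<in>UNIV - {m}. cdot (a (f k)) x)"
        by (rule prod.remove) auto
      with m show "d f * (\<Prod>k\<in>UNIV. cdot (a (f k)) x) =
          cdot (a e) x * (d f * (\<Prod>k\<in>S f. cdot (a (f k)) x))"
        by simp
    qed simp
    finally show ?thesis
      by (simp add: G_def sum_distrib_left)
  qed
  then have det: "weddle_det Q = (\<lambda>x. cdot (a e) x * G x)"
    by auto
  have "finite (S f) \<and> card (S f) = Suc 2" if f: "f \<in> F" for f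
  proof -
    obtain m where "S f = UNIV - {m}"
      using S[OF f] by blast
    then show ?thesis
      by (simp add: card_Diff_singleton)
  qed
  then have "infinite {vec.span {v} | v. v \<noteq> 0 \<and> cdot (a e) v = 0 \<and> G v = 0}"
    by (rule infinite_zeros_on_plane[where a = "\<lambda>f k. a (f k)", OF G_def])
  moreover have "partial i (weddle_det Q) v = 0" if "cdot (a e) v = 0" "G v = 0" for i v
  proof -
    \<comment> \<open>Only differentiability of \<open>G\<close> matters, since its derivative gets
      multiplied by \<open>cdot (a e) v = 0\<close>; the rules construct a value for
      \<open>D\<close>.\<close>
    have "\<exists>D. ((\<lambda>t. G (v + t *s axis i 1)) has_field_derivative D) (at 0)"
      unfolding G_def
      by (rule exI, (rule DERIV_sum DERIV_cmult has_field_derivative_prod has_field_derivative_cdot)+)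
    then show ?thesis
      unfolding det using that by (auto intro: partial_cdot_mult_eq_0)
  qed
  then have "{vec.span {v} | v. v \<noteq> 0 \<and> cdot (a e) v = 0 \<and> G v = 0} \<subseteq> weddle_singular_points Q"
    unfolding weddle_singular_points_def by blast
  ultimately show ?thesis
    using finite_subset by blast
qed

section \<open>Reduction of rank at most five to five squares\<close>

theorem corollary3p10:
  fixes L :: "form set" and Q :: "4 \<Rightarrow> form"
  assumes "quadric_system L"
    and "forms.dim L = 4"
    and "forms.span (range Q) = L"
    and "finite (weddle_singular_points Q)"
    and "card (weddle_singular_points Q) < 10"
  shows "6 \<le> system_rank L"
proof (rule ccontr)
  assume "\<not> 6 \<le> system_rank L"
  define r where "r = system_rank L"
  have "r \<le> 5"
    using \<open>\<not> 6 \<le> system_rank L\<close> by (simp add: r_def)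
  obtain l :: "nat \<Rightarrow> form" where l: "\<And>i. i < r \<Longrightarrow> linear_form (l i)"
    and L: "L \<subseteq> forms.span ((\<lambda>i x. (l i x)\<^sup>2) ` {..<r})"
    \<comment> \<open>Some finite family of squares spans a space containing \<open>L\<close>, so
      the minimum defining the rank is attained.\<close>
    using LeastI_ex[OF system_rank_witness[OF assms(1)]]
    unfolding r_def system_rank_def by blast
  have "\<exists>a. l i = cdot a" if "i < r" for i
    using l[OF that] by (simp add: linear_form_iff_cdot)
  then obtain a where a: "\<And>i. i < r \<Longrightarrow> l i = cdot (a i)"
    by metis
  have "\<exists>c. Q k = (\<lambda>x. \<Sum>j<r. c j * (l j x)\<^sup>2)" for k
  proof (rule span_image_squares)
    show "Q k \<in> forms.span ((\<lambda>j x. (l j x)\<^sup>2) ` {..<r})"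
      using L assms(3) forms.span_base[of "Q k" "range Q"] by auto
  qed simp
  then obtain c where c: "\<And>k. Q k = (\<lambda>x. \<Sum>j<r. c k j * (l j x)\<^sup>2)"
    by metis
  \<comment> \<open>Padding with zero coefficients turns \<open>r\<close> squares into five; the
    vectors \<open>a j\<close> with \<open>r \<le> j\<close> are arbitrary.\<close>
  define d where "d k j = (if j < r then c k j else 0)" for k j
  have Q: "Q k = (\<lambda>x. \<Sum>j<5. d k j * (cdot (a j) x)\<^sup>2)" for k
  proof
    fix x
    have "Q k x = (\<Sum>j<r. d k j * (cdot (a j) x)\<^sup>2)"
      by (simp add: c d_def a)
    also have "\<dots> = (\<Sum>j<5. d k j * (cdot (a j) x)\<^sup>2)"
      using \<open>r \<le> 5\<close> by (intro sum.mono_neutral_left) (auto simp: d_def)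
    finally show "Q k x = (\<Sum>j<5. d k j * (cdot (a j) x)\<^sup>2)" .
  qed
  show False
  \<comment> \<open>Special position against general position. An \<open>e\<close> outside
    \<open>{..<5}\<close> means that all five forms share a zero, which also counts as
    special.\<close>
  proof (cases "\<exists>e y. y \<noteq> 0 \<and> (\<forall>j\<in>{..<5} - {e}. cdot (a j) y = 0)")
    case True
    then obtain e y where "y \<noteq> 0" "\<And>j. j \<in> {..<5} - {e} \<Longrightarrow> cdot (a j) y = 0"
      by blast
    then have "infinite (weddle_singular_points Q)"
      by (intro infinite_weddle_singular_points_special[OF _ Q]) auto
    with assms(4) show False
      by simp
  next
    case False
    then have "10 \<le> card (weddle_singular_points Q)"
      by (intro card_weddle_singular_points_general[OF _ _ Q _ assms(4)]) auto
    with assms(5) show False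
      by simp
  qed
qed

end
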